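(* Let $G$ be a graph with $n$ vertices whose Laplacian matrix has eigenvalues $\lambda_1\le\cdots\le\lambda_n$ with corresponding mutually orthogonal real unit eigenvectors $z_1,\dots,z_n$, where $z_1=\frac1{\sqrt n}\mathbf 1$. Let $G^c$ be the complement of $G$ and suppose $G^c$ is connected. Then the biharmonic distance between two vertices $u,v$ in $G^c$ is $$d_B(u,v)=\Big(\sum_{k=2}^{n}(n-\lambda_k)^{-2}(z_k(u)-z_k(v))^2\Big)^{1/2}.$$
   Context: All graphs are finite, simple and undirected. The Laplacian matrix of a graph is $L=D-A$ ($A$ adjacency matrix, $D$ diagonal degree matrix). For a graph $H$ with Laplacian $L$, $L^{+}$ is the Moore–Penrose inverse and $L^{2+}=(L^{+})^2$; the biharmonic distance in $H$ is the nonnegative number $d_B(u,v)$ with $d_B^2(u,v)=L^{2+}_{uu}+L^{2+}_{vv}-2L^{2+}_{uv}$. $\mathbf 1$ is the all-ones vector and $z(u)$ is the $u$-coordinate of $z$. *)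

theory Defs
  imports "HOL-Analysis.Analysis"
begin

text \<open>
  A graph with \<open>n\<close> vertices is an adjacency relation on a finite vertex type \<open>'n\<close>,
  with \<open>n = CARD('n)\<close>.
\<close>

definition simple_graph :: "('n::finite \<Rightarrow> 'n \<Rightarrow> bool) \<Rightarrow> bool" where
  "simple_graph E \<longleftrightarrow> symp E \<and> irreflp E"

definition graph_complement :: "('n::finite \<Rightarrow> 'n \<Rightarrow> bool) \<Rightarrow> 'n \<Rightarrow> 'n \<Rightarrow> bool" where
  "graph_complement E u v \<longleftrightarrow> u \<noteq> v \<and> \<not> E u v"

definition graph_connected :: "('n::finite \<Rightarrow> 'n \<Rightarrow> bool) \<Rightarrow> bool" where
  "graph_connected E \<longleftrightarrow> (\<forall>u v. E\<^sup>*\<^sup>* u v)"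

definition adjacency_matrix :: "('n::finite \<Rightarrow> 'n \<Rightarrow> bool) \<Rightarrow> real ^ 'n ^ 'n" where
  "adjacency_matrix E = (\<chi> u v. if E u v then 1 else 0)"

definition degree_matrix :: "('n::finite \<Rightarrow> 'n \<Rightarrow> bool) \<Rightarrow> real ^ 'n ^ 'n" where
  "degree_matrix E = (\<chi> u v. if u = v then real (card {w. E u w}) else 0)"

definition laplacian :: "('n::finite \<Rightarrow> 'n \<Rightarrow> bool) \<Rightarrow> real ^ 'n ^ 'n" where
  "laplacian E = degree_matrix E - adjacency_matrix E"

text \<open>The four Penrose equations; over the reals the adjoint is the transpose.\<close>

definition is_moore_penrose :: "real ^ 'n ^ 'm \<Rightarrow> real ^ 'm ^ 'n \<Rightarrow> bool" where
  "is_moore_penrose A X \<longleftrightarrow>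
     A ** X ** A = A \<and> X ** A ** X = X \<and>
     transpose (A ** X) = A ** X \<and> transpose (X ** A) = X ** A"

definition moore_penrose :: "real ^ 'n ^ 'm \<Rightarrow> real ^ 'm ^ 'n" where
  "moore_penrose A = (THE X. is_moore_penrose A X)"

lemma is_moore_penrose_unique:
  fixes A :: "real ^ 'n ^ 'm" and X Y :: "real ^ 'm ^ 'n"
  assumes X: "is_moore_penrose A X" and Y: "is_moore_penrose A Y"
  shows "X = Y"
proof -
  have AX: "A ** X = A ** Y"
  proof -
    have "A ** X = transpose (A ** X)"
      using X by (simp add: is_moore_penrose_def)
    also have "\<dots> = transpose ((A ** Y) ** (A ** X))"
      using Y by (simp add: is_moore_penrose_def matrix_mul_assoc)
    also have "\<dots> = (A ** X) ** (A ** Y)"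
      using X Y by (simp only: is_moore_penrose_def matrix_transpose_mul)
    also have "\<dots> = A ** Y"
      using X by (simp add: is_moore_penrose_def matrix_mul_assoc)
    finally show ?thesis .
  qed
  have XA: "X ** A = Y ** A"
  proof -
    have "X ** A = transpose (X ** A)"
      using X by (simp add: is_moore_penrose_def)
    also have "\<dots> = transpose ((X ** A) ** (Y ** A))"
      using Y by (metis is_moore_penrose_def matrix_mul_assoc)
    also have "\<dots> = (Y ** A) ** (X ** A)"
      using X Y by (simp only: is_moore_penrose_def matrix_transpose_mul)
    also have "\<dots> = Y ** A"
      using X by (metis is_moore_penrose_def matrix_mul_assoc)
    finally show ?thesis .
  qed
  have "X = X ** A ** X"
    using X by (simp add: is_moore_penrose_def)
  also have "\<dots> = Y ** A ** Y"
    using AX XA by (metis matrix_mul_assoc)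
  also have "\<dots> = Y"
    using Y by (simp add: is_moore_penrose_def)
  finally show ?thesis .
qed

lemma moore_penrose_eqI:
  assumes "is_moore_penrose A X"
  shows "moore_penrose A = X"
  unfolding moore_penrose_def
  using assms is_moore_penrose_unique by (blast intro: the_equality)

text \<open>The radicand is nonnegative, as \<open>M\<close> is positive semidefinite.\<close>

definition biharmonic_distance :: "('n::finite \<Rightarrow> 'n \<Rightarrow> bool) \<Rightarrow> 'n \<Rightarrow> 'n \<Rightarrow> real" where
  "biharmonic_distance E u v =
     (let M = moore_penrose (laplacian E) ** moore_penrose (laplacian E)
      in sqrt (M $ u $ u + M $ v $ v - 2 * M $ u $ v))"

end

(* With J the all-ones matrix, L(G) + L(G^c) = nI - J, so an eigenvector z of L(G) orthogonal to 1 is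
   an eigenvector of L(G^c) with eigenvalue n - lambda, while L(G^c) 1 = 0.  A matrix with an orthonormal
   eigenbasis z_k is sum_k mu_k z_k z_k^T, and its Moore-Penrose inverse is obtained by inverting
   the nonzero mu_k; the convention inverse 0 = 0 takes care of the kernel. *)
theory Submission
  imports Defs
begin

definition spectral_matrix :: "('k \<Rightarrow> real ^ 'n) \<Rightarrow> 'k set \<Rightarrow> ('k \<Rightarrow> real) \<Rightarrow> real ^ 'n ^ 'n" where
  "spectral_matrix z I f = (\<chi> i j. \<Sum>k\<in>I. f k * z k $ i * z k $ j)"

lemma transpose_spectral_matrix: "transpose (spectral_matrix z I f) = spectral_matrix z I f"
  by (simp add: spectral_matrix_def transpose_def mult_ac)

lemma spectral_matrix_mult_vec:
  "spectral_matrix z I f *v x = (\<Sum>k\<in>I. (f k * (z k \<bullet> x)) *s z k)"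
proof -
  have "(\<Sum>j\<in>UNIV. (\<Sum>k\<in>I. f k * z k $ i * z k $ j) * x $ j)
      = (\<Sum>k\<in>I. f k * (\<Sum>j\<in>UNIV. z k $ j * x $ j) * z k $ i)" for i
    unfolding sum_distrib_left sum_distrib_right
    by (subst sum.swap) (simp add: mult_ac)
  then show ?thesis
    by (simp add: vec_eq_iff spectral_matrix_def matrix_vector_mult_def inner_vec_def)
qed

text \<open>Both sides are x^T M x at x = e_u - e_v: each rank-one term contributes
  \<open>f k\<close> times the square of \<open>z k \<bullet> x\<close>, and symmetry merges the two
  off-diagonal entries.\<close>

lemma spectral_matrix_quadratic_form:
  "spectral_matrix z I f $ u $ u + spectral_matrix z I f $ v $ v - 2 * spectral_matrix z I f $ u $ v
    = (\<Sum>k\<in>I. f k * (z k $ u - z k $ v)\<^sup>2)"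
  unfolding spectral_matrix_def
  by (simp add: sum_distrib_left power2_eq_square algebra_simps
      flip: sum.distrib sum_subtractf)

text \<open>The cardinality condition is what makes the orthonormal family a basis of the whole
  space.\<close>

locale orthonormal_eigenbasis =
  fixes z :: "'k \<Rightarrow> real ^ 'n::finite" and I :: "'k set"
  assumes card_index: "card I = CARD('n)"
    and unit_norm: "k \<in> I \<Longrightarrow> norm (z k) = 1"
    and orthogonal: "\<lbrakk>k \<in> I; l \<in> I; k \<noteq> l\<rbrakk> \<Longrightarrow> z k \<bullet> z l = 0"
begin

lemma finite_index: "finite I"
  \<comment> \<open>An infinite set has \<open>card\<close> 0, whereas \<open>CARD('n)\<close> is
    positive.\<close>
  using card_index by (auto intro: card_ge_0_finite)

lemma inner_self: "k \<in> I \<Longrightarrow> z k \<bullet> z k = 1"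
  using unit_norm by (simp add: norm_eq_1)

lemma span_eq_UNIV: "span (z ` I) = UNIV"
proof -
  \<comment> \<open>Distinct indices sharing one vector would give it inner product with itself both
    0 and 1.\<close>
  have "inj_on z I"
    using orthogonal inner_self by (metis inj_onI zero_neq_one)
  then have "card (z ` I) = DIM(real ^ 'n)"
    by (simp add: card_image card_index)
  moreover have "independent (z ` I)"
    using orthogonal unit_norm
    by (intro pairwise_orthogonal_independent)
      (auto simp: pairwise_def orthogonal_def, metis norm_zero zero_neq_one)
  ultimately show ?thesis
    using card_ge_dim_independent[of "z ` I" UNIV] by auto
qed

text \<open>Linear maps that agree on a spanning set agree everywhere. This reduces the product rule
  and the diagonalization of the Laplacian to eigenvalue computations.\<close>

lemma matrix_eqI:
  fixes A B :: "real ^ 'n ^ 'n"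
  assumes "\<And>k. k \<in> I \<Longrightarrow> A *v z k = B *v z k"
  shows "A = B"
proof -
  have "A *v x = B *v x" for x
    using linear_eq_on[of "(*v) A" "(*v) B" x "z ` I"] assms span_eq_UNIV by auto
  then show ?thesis
    by (simp add: matrix_eq)
qed

lemma spectral_matrix_eigenvector:
  assumes "k \<in> I"
  shows "spectral_matrix z I f *v z k = f k *s z k"
proof -
  \<comment> \<open>Orthonormality leaves only the term \<open>l = k\<close>.\<close>
  have "(\<Sum>l\<in>I. (f l * (z l \<bullet> z k)) *s z l) = (\<Sum>l\<in>I. if l = k then f k *s z k else 0)"
    using assms orthogonal inner_self by (intro sum.cong) auto
  then show ?thesis
    using assms by (simp add: spectral_matrix_mult_vec finite_index)
qed

lemma spectral_matrix_mult:
  "spectral_matrix z I f ** spectral_matrix z I g = spectral_matrix z I (\<lambda>k. f k * g k)"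
  by (rule matrix_eqI)
    (simp add: spectral_matrix_eigenvector vector_scalar_commute mult.commute
      flip: matrix_vector_mul_assoc)

text \<open>By the product rule, two Penrose equations become scalar identities in each
  \<open>f k\<close>; the other two hold because products of spectral matrices are again spectral,
  hence symmetric.\<close>

lemma moore_penrose_spectral_matrix:
  "moore_penrose (spectral_matrix z I f) = spectral_matrix z I (\<lambda>k. inverse (f k))"
proof -
  have inverse_laws: "f k * inverse (f k) * f k = f k" "inverse (f k) * f k * inverse (f k) = inverse (f k)" for k
    by (cases "f k = 0"; simp)+
  show ?thesis
    by (intro moore_penrose_eqI)
      (simp add: is_moore_penrose_def spectral_matrix_mult transpose_spectral_matrix inverse_laws)
qed

text \<open>The sum may run over kernel indices too: where \<open>mu k = 0\<close>, the weight
  \<open>0 powi (-2)\<close> is 0.\<close>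

lemma biharmonic_distance_eq:
  assumes "\<And>k. k \<in> I \<Longrightarrow> laplacian H *v z k = mu k *s z k"
  shows "biharmonic_distance H u v = sqrt (\<Sum>k\<in>I. mu k powi (-2) * (z k $ u - z k $ v)\<^sup>2)"
proof -
  have "laplacian H = spectral_matrix z I mu"
    using assms by (intro matrix_eqI) (simp add: spectral_matrix_eigenvector)
  moreover have "inverse (mu k) * inverse (mu k) = mu k powi (-2)" for k
    by (simp add: power_int_minus power2_eq_square)
  ultimately show ?thesis
    by (simp add: biharmonic_distance_def moore_penrose_spectral_matrix spectral_matrix_mult
        spectral_matrix_quadratic_form)
qed

end

lemma laplacian_graph_complement:
  fixes E :: "'n::finite \<Rightarrow> 'n \<Rightarrow> bool"
  assumes "irreflp E"
  shows "laplacian (graph_complement E) $ u $ w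
    = (if u = w then real CARD('n) else 0) - 1 - laplacian E $ u $ w"
proof -
  have not_refl: "\<not> E u u" for u
    using assms by (simp add: irreflp_def)
  \<comment> \<open>The vertex \<open>u\<close> is no neighbour of itself in either graph, so its
    two degrees add up to n - 1.\<close>
  have "insert u {w. graph_complement E u w} = - {w. E u w}"
    using not_refl by (auto simp: graph_complement_def)
  then have "Suc (card {w. graph_complement E u w}) = card (- {w. E u w})"
    by (metis card_insert_disjoint finite graph_complement_def mem_Collect_eq)
  moreover have "card {w. E u w} + card (- {w. E u w}) = CARD('n)"
    by (metis Compl_disjoint Compl_partition card_Un_disjoint finite)
  ultimately have "real (card {w. graph_complement E u w}) = real CARD('n) - 1 - real (card {w. E u w})"
    by linarith
  then show ?thesis
    using not_refl by (auto simp: laplacian_def degree_matrix_def adjacency_matrix_def)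
      (auto simp: graph_complement_def)
qed

text \<open>The middle term is J x, which vanishes when x is orthogonal to the all-ones
  vector.\<close>

lemma laplacian_graph_complement_mult_vec:
  fixes E :: "'n::finite \<Rightarrow> 'n \<Rightarrow> bool"
  assumes "irreflp E"
  shows "laplacian (graph_complement E) *v x
    = real CARD('n) *s x - (\<chi> i. \<Sum>j\<in>UNIV. x $ j) - laplacian E *v x"
  by (simp add: vec_eq_iff matrix_vector_mult_def laplacian_graph_complement[OF assms]
      left_diff_distrib sum_subtractf if_distrib[of "\<lambda>c. c * _"] cong: if_cong)

text \<open>Each row sums to the degree minus the number of neighbours.\<close>

lemma laplacian_mult_constant: "laplacian E *v (\<chi> i. c) = 0"
proof -
  have "(\<Sum>w\<in>UNIV. if E u w then 1 else 0 :: real) = real (card {w. E u w})" for u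
    by (simp flip: sum.inter_filter add: sum.If_cases)
  then show ?thesis
    by (simp add: vec_eq_iff matrix_vector_mult_def laplacian_def degree_matrix_def
        adjacency_matrix_def sum_subtractf flip: sum_distrib_right)
qed

theorem theorem5p1:
  fixes E :: "'n::finite \<Rightarrow> 'n \<Rightarrow> bool"
    and n :: nat
    and lam :: "nat \<Rightarrow> real"
    and z :: "nat \<Rightarrow> real ^ 'n"
    and u v :: 'n
  assumes "simple_graph E"
    and "n = CARD('n)"
    and "mono_on {1..n} lam"
    and "\<And>k. k \<in> {1..n} \<Longrightarrow> laplacian E *v z k = lam k *s z k"
    and "\<And>k. k \<in> {1..n} \<Longrightarrow> norm (z k) = 1"
    and "\<And>i j. i \<in> {1..n} \<Longrightarrow> j \<in> {1..n} \<Longrightarrow> i \<noteq> j \<Longrightarrow> z i \<bullet> z j = 0"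
    and "z 1 = (1 / sqrt (real n)) *s (\<chi> i. 1)"
    and "graph_connected (graph_complement E)"
  shows "biharmonic_distance (graph_complement E) u v =
    sqrt (\<Sum>k = 2..n. (real n - lam k) powi (-2) * (z k $ u - z k $ v)\<^sup>2)"
proof -
  have n_pos: "n > 0"
    using assms(2) by simp
  interpret orthonormal_eigenbasis z "{1..n}"
    using assms(2,5,6) by unfold_locales auto
  \<comment> \<open>Index 1 is exceptional: J does not annihilate the constant vector
    \<open>z 1\<close> but multiplies it by n, which cancels the contribution of nI.\<close>
  define mu where "mu k = (if k = 1 then 0 else real n - lam k)" for k
  have z1: "z 1 = (\<chi> i. 1 / sqrt (real n))"
    using assms(7) by (simp add: vec_eq_iff)
  have "laplacian (graph_complement E) *v z k = mu k *s z k" if k: "k \<in> {1..n}" for k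
  proof (cases "k = 1")
    case True
    then show ?thesis
      by (simp only: mu_def z1 laplacian_mult_constant) simp
  next
    case False
    then have "z 1 \<bullet> z k = 0"
      using k n_pos by (intro assms(6)) auto
    then have "(\<Sum>j\<in>UNIV. z k $ j) = 0"
      using n_pos unfolding z1 by (simp add: inner_vec_def flip: sum_divide_distrib)
    then show ?thesis
      using False k assms(1,2,4)
      by (simp add: simple_graph_def laplacian_graph_complement_mult_vec mu_def vec_eq_iff
          left_diff_distrib)
  qed
  then have "biharmonic_distance (graph_complement E) u v
      = sqrt (\<Sum>k = 1..n. mu k powi (-2) * (z k $ u - z k $ v)\<^sup>2)"
    by (rule biharmonic_distance_eq)
  also have "(\<Sum>k = 1..n. mu k powi (-2) * (z k $ u - z k $ v)\<^sup>2)
      = (\<Sum>k = 2..n. (real n - lam k) powi (-2) * (z k $ u - z k $ v)\<^sup>2)"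
    \<comment> \<open>The split-off first term is zero, since \<open>mu 1 = 0\<close> and
      \<open>0 powi (-2) = 0\<close>.\<close>
    using n_pos by (simp add: sum.atLeast_Suc_atMost mu_def numeral_2_eq_2)
  finally show ?thesis .
qed

end
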